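(* Suppose that (1) $\theta\mapsto P_\theta(A)$ is measurable for every $A\in\mathcal{A}$, and (2) for all $\theta,\theta'\in\Theta$, $\theta\neq\theta'$ implies $P_\theta\neq P_{\theta'}$. Let $(X,\boldsymbol{\theta})\sim\mu$, where $X=(X_1,X_2,\dots)$. If $g:\Theta\to\mathbb{R}$ is a measurable function such that $\mathbb{E}|g(\boldsymbol{\theta})|<\infty$, then $$\lim_{n\to\infty}\mathbb{E}\bigl(g(\boldsymbol{\theta})\mid X_1,\dots,X_n\bigr)=g(\boldsymbol{\theta})\quad\text{$\mu$-almost surely.}$$
   Context: Let $\widehat{\mathcal{X}}$ and $\widehat\Theta$ be complete separable metric spaces. Let $\mathcal{X}\subseteq\widehat{\mathcal{X}}$ and $\Theta\subseteq\widehat\Theta$ be Borel measurable subsets, with induced Borel $\sigma$-algebras $\mathcal{A}$ and $\mathcal{B}$ respectively. For each $\theta\in\Theta$, let $P_\theta$ be a probability measure on $(\mathcal{X},\mathcal{A})$. Let $\Pi$ be a probability measure on $(\Theta,\mathcal{B})$. Let $\mathcal{X}^\infty=\mathcal{X}\times\mathcal{X}\times\cdots$ with product $\sigma$-algebra $\mathcal{A}^\infty$, and let $P_\theta^\infty$ be the infinite product probability measure on $(\mathcal{X}^\infty,\mathcal{A}^\infty)$ obtained from $P_\theta$. The joint distribution $\mu$ of $((X_1,X_2,\dots),\boldsymbol{\theta})$ is defined by letting $\boldsymbol{\theta}\sim\Pi$ and $X_1,X_2,\dots\mid\boldsymbol{\theta}$ i.i.d. $\sim P_{\boldsymbol{\theta}}$;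 that is, $\mu$ is the probability measure on $(\mathcal{X}^\infty\times\Theta,\mathcal{A}^\infty\otimes\mathcal{B})$ given by $\mu(E)=\int_\Theta P_\theta^\infty(E_\theta)\,d\Pi(\theta)$, where $E_\theta=\{x\in\mathcal{X}^\infty:(x,\theta)\in E\}$ (this is well-defined when condition (1) holds). The symbol $\theta$ denotes fixed values in $\Theta$ and $\boldsymbol{\theta}$ a random variable with values in $\Theta$. Expectations and conditional expectations are computed under $\mu$. "Almost surely" means that there is a measurable set of measure 1 on which the condition holds. *)

theory Defs
  imports "HOL-Probability.Probability"
begin

text \<open>The joint law of a parameter drawn from \<open>\<pi>\<close> and an i.i.d. sequence drawn from \<open>P \<theta>\<close>.
  Of \<open>A\<close> only the space and the sets matter: it is the common \<open>\<sigma>\<close>-algebra of the \<open>P \<theta>\<close>.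
  If the set function were not countably additive, \<^const>\<open>measure_of\<close> would silently
  return the zero measure; \<open>emeasure_iid_joint\<close> below excludes this for measurable
  families of probability measures.\<close>

definition iid_joint ::
  "'a measure \<Rightarrow> ('b \<Rightarrow> 'a measure) \<Rightarrow> 'b measure \<Rightarrow> ((nat \<Rightarrow> 'a) \<times> 'b) measure" where
  "iid_joint A P \<pi> =
     measure_of (space ((\<Pi>\<^sub>M i\<in>UNIV. A) \<Otimes>\<^sub>M \<pi>)) (sets ((\<Pi>\<^sub>M i\<in>UNIV. A) \<Otimes>\<^sub>M \<pi>))
       (\<lambda>E. \<integral>\<^sup>+\<theta>. emeasure (\<Pi>\<^sub>M i\<in>UNIV. P \<theta>) ((\<lambda>x. (x, \<theta>)) -` E) \<partial>\<pi>)"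

text \<open>The \<open>\<sigma>\<close>-algebra on the joint space generated by the first \<open>n\<close> observations, which
  are the coordinates \<open>0, \<dots>, n - 1\<close>.\<close>

definition obs_algebra :: "'a measure \<Rightarrow> ((nat \<Rightarrow> 'a) \<times> 'b) measure \<Rightarrow> nat \<Rightarrow> ((nat \<Rightarrow> 'a) \<times> 'b) measure" where
  "obs_algebra A M n =
     vimage_algebra (space M) (\<lambda>\<omega>. restrict (fst \<omega>) {..<n}) (\<Pi>\<^sub>M i\<in>{..<n}. A)"

lemma space_iid_joint [simp]: "space (iid_joint A P \<pi>) = space ((\<Pi>\<^sub>M i\<in>UNIV. A) \<Otimes>\<^sub>M \<pi>)"
  by (simp add: iid_joint_def space_measure_of_conv)

lemma sets_iid_joint [simp, measurable_cong]:
  "sets (iid_joint A P \<pi>) = sets ((\<Pi>\<^sub>M i\<in>UNIV. A) \<Otimes>\<^sub>M \<pi>)"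
  by (simp add: iid_joint_def sets.space_closed)

lemma subalgebra_obs_algebra: "subalgebra (iid_joint A P \<pi>) (obs_algebra A (iid_joint A P \<pi>) n)"
proof -
  have "(\<lambda>\<omega>. restrict (fst \<omega>) {..<n}) \<in> iid_joint A P \<pi> \<rightarrow>\<^sub>M (\<Pi>\<^sub>M i\<in>{..<n}. A)"
    by (rule measurable_compose[OF _ measurable_restrict_subset[of _ UNIV]]) measurable
  then show ?thesis
    unfolding subalgebra_def obs_algebra_def
    by (auto simp: measurable_iff_sets)
qed

lemma measurable_iid_kernel:
  assumes prob: "\<And>\<theta>. \<theta> \<in> space M \<Longrightarrow> prob_space (P \<theta>)"
    and sets_P: "\<And>\<theta>. \<theta> \<in> space M \<Longrightarrow> sets (P \<theta>) = sets A"
    and meas: "\<And>B. B \<in> sets A \<Longrightarrow> (\<lambda>\<theta>. measure (P \<theta>) B) \<in> borel_measurable M"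
  shows "(\<lambda>\<theta>. \<Pi>\<^sub>M i\<in>(UNIV :: nat set). P \<theta>) \<in> M \<rightarrow>\<^sub>M prob_algebra (\<Pi>\<^sub>M i\<in>UNIV. A)"
proof (rule measurable_prob_algebraI)
  show prob_K: "prob_space (\<Pi>\<^sub>M i\<in>(UNIV :: nat set). P \<theta>)" if "\<theta> \<in> space M" for \<theta>
    by (intro prob_space_PiM prob that)
  have sets_K: "sets (\<Pi>\<^sub>M i\<in>(UNIV :: nat set). P \<theta>) = sets (\<Pi>\<^sub>M i\<in>UNIV. A)" if "\<theta> \<in> space M" for \<theta>
    by (intro sets_PiM_cong refl sets_P that)
  show "(\<lambda>\<theta>. \<Pi>\<^sub>M i\<in>(UNIV :: nat set). P \<theta>) \<in> M \<rightarrow>\<^sub>M subprob_algebra (\<Pi>\<^sub>M i\<in>UNIV. A)"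
  proof (rule measurable_subprob_algebra_generated[OF sets_PiM Int_stable_prod_algebra prod_algebra_sets_into_space])
    fix \<theta> assume \<theta>: "\<theta> \<in> space M"
    show "subprob_space (\<Pi>\<^sub>M i\<in>(UNIV :: nat set). P \<theta>)"
      by (rule prob_space_imp_subprob_space[OF prob_K[OF \<theta>]])
    show "sets (\<Pi>\<^sub>M i\<in>(UNIV :: nat set). P \<theta>) = sets (\<Pi>\<^sub>M i\<in>UNIV. A)"
      by (rule sets_K[OF \<theta>])
  next
    have "emeasure (\<Pi>\<^sub>M i\<in>(UNIV :: nat set). P \<theta>) (\<Pi>\<^sub>E i\<in>UNIV. space A) = 1" if "\<theta> \<in> space M" for \<theta>
      using prob_space.emeasure_space_1[OF prob_K[OF that]] sets_eq_imp_space_eq[OF sets_K[OF that]]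
      by (simp add: space_PiM)
    then show "(\<lambda>\<theta>. emeasure (\<Pi>\<^sub>M i\<in>(UNIV :: nat set). P \<theta>) (\<Pi>\<^sub>E i\<in>UNIV. space A)) \<in> borel_measurable M"
      by (simp cong: measurable_cong)
next
  fix C assume "C \<in> prod_algebra (UNIV :: nat set) (\<lambda>_. A)"
  then obtain J E where C: "C = prod_emb UNIV (\<lambda>_. A) J (\<Pi>\<^sub>E j\<in>J. E j)"
    and J: "finite J" and E: "\<And>i. i \<in> J \<Longrightarrow> E i \<in> sets A"
    by (elim prod_algebraE) auto
  have "emeasure (\<Pi>\<^sub>M i\<in>(UNIV :: nat set). P \<theta>) C = (\<Prod>j\<in>J. ennreal (measure (P \<theta>) (E j)))"
    if \<theta>: "\<theta> \<in> space M" for \<theta>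
  proof -
    interpret prob_space "P \<theta>" using prob[OF \<theta>] .
    have "C = prod_emb UNIV (\<lambda>_. P \<theta>) J (\<Pi>\<^sub>E j\<in>J. E j)"
      using sets_eq_imp_space_eq[OF sets_P[OF \<theta>]] by (simp add: C prod_emb_def)
    then show ?thesis
      using J E sets_P[OF \<theta>] prob[OF \<theta>]
      by (simp add: emeasure_PiM_emb emeasure_eq_measure)
  qed
  moreover have "(\<lambda>\<theta>. \<Prod>j\<in>J. ennreal (measure (P \<theta>) (E j))) \<in> borel_measurable M"
    using meas E by (intro borel_measurable_prod_ennreal measurable_compose[OF _ measurable_ennreal]) auto
  ultimately show "(\<lambda>\<theta>. emeasure (\<Pi>\<^sub>M i\<in>(UNIV :: nat set). P \<theta>) C) \<in> borel_measurable M"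
    by (simp cong: measurable_cong)
  qed
qed

lemma emeasure_iid_joint:
  fixes A :: "'a measure" and \<pi> :: "'b measure"
  assumes prob: "\<And>\<theta>. \<theta> \<in> space \<pi> \<Longrightarrow> prob_space (P \<theta>)"
    and sets_P: "\<And>\<theta>. \<theta> \<in> space \<pi> \<Longrightarrow> sets (P \<theta>) = sets A"
    and meas: "\<And>B. B \<in> sets A \<Longrightarrow> (\<lambda>\<theta>. measure (P \<theta>) B) \<in> borel_measurable \<pi>"
    and E: "E \<in> sets ((\<Pi>\<^sub>M i\<in>UNIV. A) \<Otimes>\<^sub>M \<pi>)"
  shows "emeasure (iid_joint A P \<pi>) E =
    (\<integral>\<^sup>+\<theta>. emeasure (\<Pi>\<^sub>M i\<in>UNIV. P \<theta>) ((\<lambda>x. (x, \<theta>)) -` E) \<partial>\<pi>)"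
proof -
  let ?S = "\<Pi>\<^sub>M i\<in>(UNIV :: nat set). A" and ?K = "\<lambda>\<theta>. \<Pi>\<^sub>M i\<in>(UNIV :: nat set). P \<theta>"
  let ?sec = "\<lambda>F \<theta>. (\<lambda>x. (x, \<theta>)) -` F"
  have K: "?K \<in> \<pi> \<rightarrow>\<^sub>M subprob_algebra ?S"
    by (intro measurable_prob_algebraD measurable_iid_kernel prob sets_P meas)
  have sec_sets: "?sec F \<theta> \<in> sets (?K \<theta>)" if "F \<in> sets (?S \<Otimes>\<^sub>M \<pi>)" "\<theta> \<in> space \<pi>" for F \<theta>
  proof -
    have "sets (?K \<theta>) = sets ?S"
      by (intro sets_PiM_cong refl sets_P that(2))
    then show ?thesis
      using sets_Pair2[OF that(1), of \<theta>] by simp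
  qed
  have sec_meas: "(\<lambda>\<theta>. emeasure (?K \<theta>) (?sec F \<theta>)) \<in> borel_measurable \<pi>"
    if F: "F \<in> sets (?S \<Otimes>\<^sub>M \<pi>)" for F
  proof (rule emeasure_measurable_subprob_algebra2[OF _ K])
    have "(SIGMA \<theta>:space \<pi>. ?sec F \<theta>) = (\<lambda>(\<theta>, x). (x, \<theta>)) -` F \<inter> space (\<pi> \<Otimes>\<^sub>M ?S)"
      using sets.sets_into_space[OF F] by (auto simp: space_pair_measure)
    also have "\<dots> \<in> sets (\<pi> \<Otimes>\<^sub>M ?S)"
      using measurable_pair_swap'[of \<pi> ?S] F by (rule measurable_sets)
    finally show "(SIGMA \<theta>:space \<pi>. ?sec F \<theta>) \<in> sets (\<pi> \<Otimes>\<^sub>M ?S)" .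
  qed
  show ?thesis
  proof (rule emeasure_measure_of[OF iid_joint_def])
    show "sets (?S \<Otimes>\<^sub>M \<pi>) \<subseteq> Pow (space (?S \<Otimes>\<^sub>M \<pi>))"
      by (rule sets.space_closed)
    show "E \<in> sets (iid_joint A P \<pi>)"
      using E by simp
    show "positive (sets (iid_joint A P \<pi>)) (\<lambda>E. \<integral>\<^sup>+\<theta>. emeasure (?K \<theta>) (?sec E \<theta>) \<partial>\<pi>)"
      by (simp add: positive_def)
    show "countably_additive (sets (iid_joint A P \<pi>)) (\<lambda>E. \<integral>\<^sup>+\<theta>. emeasure (?K \<theta>) (?sec E \<theta>) \<partial>\<pi>)"
    proof (rule countably_additiveI)
      fix F :: "nat \<Rightarrow> ((nat \<Rightarrow> 'a) \<times> 'b) set"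
      assume "range F \<subseteq> sets (iid_joint A P \<pi>)" and disj: "disjoint_family F"
      then have F: "F i \<in> sets (?S \<Otimes>\<^sub>M \<pi>)" for i
        by auto
      have "(\<Sum>i. \<integral>\<^sup>+\<theta>. emeasure (?K \<theta>) (?sec (F i) \<theta>) \<partial>\<pi>)
          = (\<integral>\<^sup>+\<theta>. (\<Sum>i. emeasure (?K \<theta>) (?sec (F i) \<theta>)) \<partial>\<pi>)"
        by (rule nn_integral_suminf[symmetric]) (rule sec_meas[OF F])
      also have "\<dots> = (\<integral>\<^sup>+\<theta>. emeasure (?K \<theta>) (?sec (\<Union>i. F i) \<theta>) \<partial>\<pi>)"
      proof (rule nn_integral_cong)
        fix \<theta> assume "\<theta> \<in> space \<pi>"
        then have "(\<Sum>i. emeasure (?K \<theta>) (?sec (F i) \<theta>)) = emeasure (?K \<theta>) (\<Union>i. ?sec (F i) \<theta>)"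
          using sec_sets[OF F] disj
          by (intro suminf_emeasure) (fastforce simp: disjoint_family_on_def disjoint_iff)+
        then show "(\<Sum>i. emeasure (?K \<theta>) (?sec (F i) \<theta>)) = emeasure (?K \<theta>) (?sec (\<Union>i. F i) \<theta>)"
          by (simp add: vimage_UN)
      qed
      finally show "(\<Sum>i. \<integral>\<^sup>+\<theta>. emeasure (?K \<theta>) (?sec (F i) \<theta>) \<partial>\<pi>)
          = (\<integral>\<^sup>+\<theta>. emeasure (?K \<theta>) (?sec (\<Union>i. F i) \<theta>) \<partial>\<pi>)" .
    qed
  qed
qed

end

theory Submission
  imports Defs
begin

text \<open>
  The statement is Doob's consistency theorem. It has two ingredients: conditional expectations
  given more and more observations converge to a limit that is as good as knowing the whole
  sequence, and the whole sequence reveals the parameter almost surely.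

  The first is Levy's upward theorem (\<open>levy_upward\<close>). Here it is stated for functions that are
  \<open>L\<^sup>1\<close>-limits of functions of finitely many observations (\<open>L1_approximable\<close>), and it follows from
  the maximal inequality \<open>doob_maximal_inequality\<close>: for a function of the first \<open>m\<close> observations the
  claim is trivial, and the maximal inequality lets it pass to \<open>L\<^sup>1\<close>-limits.

  It remains to see that \<open>g \<theta>\<close> is such an \<open>L\<^sup>1\<close>-limit (\<open>L1_approximable_parameter\<close>). Choose
  countably many sets \<open>B k\<close> whose probabilities determine a probability measure on the sample space.
  By identifiability the map \<open>F\<close> taking \<open>\<theta>\<close> to the sequence of all \<open>P \<theta> (B k)\<close> is injective. By
  the strong law (\<open>strong_law_bounded\<close>), \<open>F \<theta>\<close> is the almost sure limit of the vectors of relative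
  frequencies of the \<open>B k\<close> among the observations, so any bounded continuous function of \<open>F \<theta>\<close> is an
  \<open>L\<^sup>1\<close>-limit of the required kind.

  To pass from continuous functions of \<open>F \<theta>\<close> to arbitrary events \<open>D\<close> about \<open>\<theta>\<close>, one needs that the
  inverse of \<open>F\<close> is measurable. The classical argument uses the Lusin-Souslin theorem. Since null sets
  may be neglected, Lusin's theorem (\<open>lusin\<close>) is enough: \<open>D\<close> contains a compact set \<open>K\<close> of nearly the
  same measure on which \<open>F\<close> is continuous. Then \<open>F ` K\<close> is compact, and by injectivity \<open>\<theta> \<in> K\<close> exactly
  if \<open>F \<theta> \<in> F ` K\<close>, a condition that is a limit of continuous functions of \<open>F \<theta>\<close>.
\<close>

section \<open>Approximation along a filtration and martingale convergence\<close>

text \<open>Convergence as a countable conjunction of tail events: in this form it is visibly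
  measurable, and an almost sure statement may be proved for each \<open>k\<close> separately.\<close>

lemma LIMSEQ_iff_inverse_Suc:
  fixes X :: "nat \<Rightarrow> real"
  shows "X \<longlonglongrightarrow> L \<longleftrightarrow> (\<forall>k. eventually (\<lambda>n. \<bar>X n - L\<bar> < 1 / real (Suc k)) sequentially)"
proof
  assume "X \<longlonglongrightarrow> L"
  then show "\<forall>k. eventually (\<lambda>n. \<bar>X n - L\<bar> < 1 / real (Suc k)) sequentially"
    unfolding tendsto_iff dist_real_def by simp
next
  assume ev: "\<forall>k. eventually (\<lambda>n. \<bar>X n - L\<bar> < 1 / real (Suc k)) sequentially"
  show "X \<longlonglongrightarrow> L"
  proof (rule tendstoI)
    fix e :: real assume "0 < e"
    then obtain k where "1 / real (Suc k) < e"
      using nat_approx_posE by blast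
    then show "eventually (\<lambda>n. dist (X n) L < e) sequentially"
      using ev[rule_format, of k] by (auto simp: dist_real_def elim: eventually_mono)
  qed
qed

text \<open>For an increasing family \<open>F\<close> of subalgebras this says that \<open>f\<close> agrees almost everywhere
  with an integrable function that is measurable for the \<open>\<sigma>\<close>-algebra generated by all \<open>F m\<close>.
  Stated through approximation, it avoids completions of that \<open>\<sigma>\<close>-algebra, and it is what the
  convergence theorem below consumes.\<close>

definition L1_approximable :: "'a measure \<Rightarrow> (nat \<Rightarrow> 'a measure) \<Rightarrow> ('a \<Rightarrow> real) \<Rightarrow> bool" where
  "L1_approximable M F f \<longleftrightarrow> integrable M f \<and> (\<forall>e>0. \<exists>m h. integrable M h \<and>
     h \<in> borel_measurable (F m) \<and> (\<integral>x. \<bar>f x - h x\<bar> \<partial>M) < e)"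

lemma L1_approximableI:
  assumes "integrable M f" "f \<in> borel_measurable (F m)"
  shows "L1_approximable M F f"
  unfolding L1_approximable_def
proof (intro conjI allI impI)
  show "\<exists>m h. integrable M h \<and> h \<in> borel_measurable (F m) \<and> (\<integral>x. \<bar>f x - h x\<bar> \<partial>M) < e"
    if "0 < e" for e
    using assms that by (intro exI[of _ m] exI[of _ f]) simp
qed (rule assms)

lemma L1_approximable_closed:
  assumes f: "integrable M f"
    and near: "\<And>e. 0 < e \<Longrightarrow> \<exists>g. L1_approximable M F g \<and> (\<integral>x. \<bar>f x - g x\<bar> \<partial>M) < e"
  shows "L1_approximable M F f"
  unfolding L1_approximable_def
proof (intro conjI allI impI f)
  fix e :: real assume e: "0 < e"
  obtain g where g: "L1_approximable M F g" "(\<integral>x. \<bar>f x - g x\<bar> \<partial>M) < e / 2"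
    using near[of "e / 2"] e by auto
  then obtain m h where h: "integrable M h" "h \<in> borel_measurable (F m)" "(\<integral>x. \<bar>g x - h x\<bar> \<partial>M) < e / 2"
    using e unfolding L1_approximable_def by (meson half_gt_zero)
  have g_int: "integrable M g"
    using g(1) by (simp add: L1_approximable_def)
  have "(\<integral>x. \<bar>f x - h x\<bar> \<partial>M) \<le> (\<integral>x. \<bar>f x - g x\<bar> + \<bar>g x - h x\<bar> \<partial>M)"
    using f g_int h(1) by (intro integral_mono) auto
  also have "\<dots> = (\<integral>x. \<bar>f x - g x\<bar> \<partial>M) + (\<integral>x. \<bar>g x - h x\<bar> \<partial>M)"
    using f g_int h(1) by (intro Bochner_Integration.integral_add) auto
  finally show "\<exists>m h. integrable M h \<and> h \<in> borel_measurable (F m) \<and> (\<integral>x. \<bar>f x - h x\<bar> \<partial>M) < e"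
    using h g(2) by (intro exI[of _ m] exI[of _ h]) auto
qed

text \<open>Dominated convergence turns almost sure limits into \<open>L\<^sup>1\<close> limits.\<close>

lemma L1_approximable_lim:
  fixes s :: "nat \<Rightarrow> 'a \<Rightarrow> real"
  assumes s: "\<And>i. L1_approximable M F (s i)"
    and f: "f \<in> borel_measurable M"
    and lim: "AE x in M. (\<lambda>i. s i x) \<longlonglongrightarrow> f x"
    and w: "integrable M w" "\<And>i x. x \<in> space M \<Longrightarrow> \<bar>s i x\<bar> \<le> w x"
  shows "L1_approximable M F f"
proof (rule L1_approximable_closed)
  have s_int: "integrable M (s i)" for i
    using s by (simp add: L1_approximable_def)
  note [measurable] = f borel_measurable_integrable[OF s_int]
  have bound: "AE x in M. \<bar>f x\<bar> \<le> w x"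
    using lim
  proof (rule AE_mp, intro AE_I2 impI)
    fix x assume "x \<in> space M" and "(\<lambda>i. s i x) \<longlonglongrightarrow> f x"
    then show "\<bar>f x\<bar> \<le> w x"
      using w(2) by (intro LIMSEQ_le_const2[OF tendsto_rabs]) auto
  qed
  show f_int: "integrable M f"
    by (rule Bochner_Integration.integrable_bound[OF w(1) f]) (use bound in \<open>eventually_elim, auto\<close>)
  fix e :: real assume e: "0 < e"
  have "(\<lambda>i. \<integral>x. \<bar>f x - s i x\<bar> \<partial>M) \<longlonglongrightarrow> (\<integral>x. 0 \<partial>M)"
  proof (rule integral_dominated_convergence[where w = "\<lambda>x. 2 * w x"])
    show "AE x in M. (\<lambda>i. \<bar>f x - s i x\<bar>) \<longlonglongrightarrow> 0"
      using lim by eventually_elim (auto intro!: tendsto_eq_intros)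
    show "AE x in M. norm \<bar>f x - s i x\<bar> \<le> 2 * w x" for i
      using bound AE_space
    proof eventually_elim
      case (elim x)
      then show ?case using w(2)[of x i] by simp
    qed
  qed (use w(1) in auto)
  then have "eventually (\<lambda>i. (\<integral>x. \<bar>f x - s i x\<bar> \<partial>M) < e) sequentially"
    using e by (intro order_tendstoD(2)) auto
  then show "\<exists>g. L1_approximable M F g \<and> (\<integral>x. \<bar>f x - g x\<bar> \<partial>M) < e"
    using s by (auto simp: eventually_sequentially)
qed

lemma L1_approximable_cmult:
  assumes "L1_approximable M F f"
  shows "L1_approximable M F (\<lambda>x. c * f x)"
  unfolding L1_approximable_def
proof (intro conjI allI impI)
  show "integrable M (\<lambda>x. c * f x)"
    using assms by (simp add: L1_approximable_def)
  fix e :: real assume e: "0 < e"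
  then have "0 < e / (\<bar>c\<bar> + 1)"
    by (simp add: add_nonneg_pos)
  then obtain m h where h: "integrable M h" "h \<in> borel_measurable (F m)"
      "(\<integral>x. \<bar>f x - h x\<bar> \<partial>M) < e / (\<bar>c\<bar> + 1)"
    using assms unfolding L1_approximable_def by blast
  have "(\<integral>x. \<bar>c * f x - c * h x\<bar> \<partial>M) = \<bar>c\<bar> * (\<integral>x. \<bar>f x - h x\<bar> \<partial>M)"
    by (simp flip: right_diff_distrib add: abs_mult)
  also have "\<dots> \<le> (\<bar>c\<bar> + 1) * (\<integral>x. \<bar>f x - h x\<bar> \<partial>M)"
    by (intro mult_right_mono) auto
  also have "\<dots> < e"
    using h(3) by (simp add: pos_less_divide_eq add_nonneg_pos mult.commute)
  finally show "\<exists>m h. integrable M h \<and> h \<in> borel_measurable (F m) \<and> (\<integral>x. \<bar>c * f x - h x\<bar> \<partial>M) < e"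
    using h by (intro exI[of _ m] exI[of _ "\<lambda>x. c * h x"]) auto
qed

lemma L1_approximable_add:
  assumes mono: "\<And>m n. m \<le> n \<Longrightarrow> subalgebra (F n) (F m)"
    and fg: "L1_approximable M F f" "L1_approximable M F g"
  shows "L1_approximable M F (\<lambda>x. f x + g x)"
  unfolding L1_approximable_def
proof (intro conjI allI impI)
  have int: "integrable M f" "integrable M g"
    using fg by (auto simp: L1_approximable_def)
  then show "integrable M (\<lambda>x. f x + g x)"
    by simp
  fix e :: real assume e: "0 < e"
  then have e2: "0 < e / 2"
    by simp
  obtain m h where h: "integrable M h" "h \<in> borel_measurable (F m)" "(\<integral>x. \<bar>f x - h x\<bar> \<partial>M) < e / 2"
    using fg(1) e2 unfolding L1_approximable_def by blast
  obtain n k where k: "integrable M k" "k \<in> borel_measurable (F n)" "(\<integral>x. \<bar>g x - k x\<bar> \<partial>M) < e / 2"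
    using fg(2) e2 unfolding L1_approximable_def by blast
  have "h \<in> borel_measurable (F (max m n))" "k \<in> borel_measurable (F (max m n))"
    using measurable_from_subalg[OF mono h(2)] measurable_from_subalg[OF mono k(2)] by auto
  then have "(\<lambda>x. h x + k x) \<in> borel_measurable (F (max m n))"
    by measurable
  moreover have "(\<integral>x. \<bar>f x + g x - (h x + k x)\<bar> \<partial>M) < e"
  proof -
    have "(\<integral>x. \<bar>f x + g x - (h x + k x)\<bar> \<partial>M) \<le> (\<integral>x. \<bar>f x - h x\<bar> + \<bar>g x - k x\<bar> \<partial>M)"
      using int h(1) k(1) by (intro integral_mono) auto
    also have "\<dots> = (\<integral>x. \<bar>f x - h x\<bar> \<partial>M) + (\<integral>x. \<bar>g x - k x\<bar> \<partial>M)"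
      using int h(1) k(1) by (intro Bochner_Integration.integral_add) auto
    finally show ?thesis
      using h(3) k(3) by simp
  qed
  ultimately show "\<exists>m h. integrable M h \<and> h \<in> borel_measurable (F m) \<and>
      (\<integral>x. \<bar>f x + g x - h x\<bar> \<partial>M) < e"
    using h(1) k(1) by (intro exI[of _ "max m n"] exI[of _ "\<lambda>x. h x + k x"]) auto
qed

text \<open>Decompose the event according to the first \<open>n\<close> at which the conditional expectation exceeds
  \<open>c\<close>. The piece \<open>A n\<close> lies in \<open>F n\<close>, so on it \<open>u\<close> has the same integral as its conditional
  expectation, which is at least \<open>c\<close> times the probability of \<open>A n\<close>; the pieces are disjoint.\<close>

lemma (in prob_space) doob_maximal_inequality:
  fixes u :: "'a \<Rightarrow> real"
  assumes subalg: "\<And>n. subalgebra M (F n)"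
    and mono: "\<And>m n. m \<le> n \<Longrightarrow> sets (F m) \<subseteq> sets (F n)"
    and u: "integrable M u" "\<And>x. x \<in> space M \<Longrightarrow> 0 \<le> u x"
    and c: "0 < c"
  shows "prob {x \<in> space M. \<exists>n::nat. c < real_cond_exp M (F n) u x} \<le> expectation u / c"
proof -
  interpret F: finite_measure_subalgebra M "F n" for n
    by unfold_locales (rule subalg)
  define B where "B n = {x \<in> space M. c < real_cond_exp M (F n) u x}" for n
  define A where "A = disjointed B"
  have space_F: "space (F n) = space M" and F_M: "sets (F n) \<subseteq> events" for n
    using subalg[of n] by (auto simp: subalgebra_def)
  have B: "B n \<in> sets (F n)" for n
    unfolding B_def space_F[of n, symmetric] by measurable
  have A: "A n \<in> sets (F n)" for n
    unfolding A_def disjointed_def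
    by (intro sets.Diff sets.finite_UN B subsetD[OF mono B]) auto
  have A_M: "A n \<in> events" for n
    using A F_M by blast
  have disj: "disjoint_family A"
    unfolding A_def by (rule disjoint_family_disjointed)
  have step: "c * prob (A n) \<le> (\<integral>x\<in>A n. u x \<partial>M)" for n
  proof -
    have "c * prob (A n) = (\<integral>x\<in>A n. c \<partial>M)"
      using A_M by (simp add: set_lebesgue_integral_def emeasure_eq_measure)
    also have "\<dots> \<le> (\<integral>x\<in>A n. real_cond_exp M (F n) u x \<partial>M)"
    proof (rule set_integral_mono)
      show "set_integrable M (A n) (\<lambda>x. c)"
        using A_M by (simp add: set_integrable_def emeasure_eq_measure)
      show "set_integrable M (A n) (real_cond_exp M (F n) u)"
        using A_M[of n] F.real_cond_exp_int(1)[OF u(1), of n] unfolding set_integrable_def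
        by (intro integrable_mult_indicator) auto
      show "c \<le> real_cond_exp M (F n) u x" if "x \<in> A n" for x
        using that disjointed_subset[of B n] by (auto simp: A_def B_def)
    qed
    also have "\<dots> = (\<integral>x\<in>A n. u x \<partial>M)"
      by (rule F.real_cond_exp_intA[OF u(1) A, symmetric])
    finally show ?thesis .
  qed
  have int_u: "set_integrable M X u" if "X \<in> events" for X
    using that u(1) unfolding set_integrable_def by (intro integrable_mult_indicator) auto
  have "(\<Sum>n<N. prob (A n)) \<le> expectation u / c" for N
  proof -
    have "c * (\<Sum>n<N. prob (A n)) \<le> (\<Sum>n<N. \<integral>x\<in>A n. u x \<partial>M)"
      unfolding sum_distrib_left by (intro sum_mono step)
    also have "\<dots> = (\<integral>x\<in>(\<Union>n<N. A n). u x \<partial>M)"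
      using disj A_M int_u
      by (intro set_integral_finite_Union[symmetric]) (auto simp: disjoint_family_on_def)
    also have "\<dots> \<le> (\<integral>x. u x \<partial>M)"
      unfolding set_lebesgue_integral_def using u A_M int_u[of "\<Union>n<N. A n"]
      by (intro integral_mono) (auto simp: set_integrable_def indicator_def)
    finally show ?thesis
      using c by (simp add: field_simps)
  qed
  moreover have "(\<lambda>n. prob (A n)) sums prob (\<Union>n. A n)"
    using A_M disj by (intro finite_measure_UNION) auto
  moreover have "(\<Union>n. A n) = {x \<in> space M. \<exists>n. c < real_cond_exp M (F n) u x}"
    unfolding A_def UN_disjointed_eq by (auto simp: B_def)
  ultimately show ?thesis
    by (metis suminf_le_const sums_iff)
qed

text \<open>For an \<open>F m\<close>-measurable \<open>h\<close> the conditional expectations are \<open>h\<close> itself from index \<open>m\<close> on.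
  Replacing \<open>f\<close> by such an \<open>h\<close> costs, from index \<open>m\<close> on, at most the conditional expectations of
  \<open>u = \<bar>f - h\<bar>\<close> plus \<open>u\<close> itself; the maximal inequality and Markov's inequality bound the
  probability that one of these is large by a multiple of the \<open>L\<^sup>1\<close> distance of \<open>f\<close> and \<open>h\<close>,
  which is as small as desired.\<close>

lemma (in prob_space) levy_upward:
  fixes f :: "'a \<Rightarrow> real"
  assumes subalg: "\<And>n::nat. subalgebra M (F n)"
    and mono: "\<And>m n. m \<le> n \<Longrightarrow> sets (F m) \<subseteq> sets (F n)"
    and approx: "L1_approximable M F f"
  shows "AE x in M. (\<lambda>n. real_cond_exp M (F n) f x) \<longlonglongrightarrow> f x"
proof -
  interpret F: finite_measure_subalgebra M "F n" for n
    by unfold_locales (rule subalg)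
  let ?E = "\<lambda>n. real_cond_exp M (F n)"
  have f: "integrable M f"
    using approx by (simp add: L1_approximable_def)
  note [measurable] = borel_measurable_integrable[OF f]
  have "AE x in M. eventually (\<lambda>n. \<bar>?E n f x - f x\<bar> < d) sequentially" if d: "0 < d" for d
  proof -
    define c where "c = d / 3"
    have c: "0 < c" and cd: "2 * c < d"
      using d by (simp_all add: c_def)
    define Z where "Z = {x \<in> space M. \<not> eventually (\<lambda>n. \<bar>?E n f x - f x\<bar> < d) sequentially}"
    have [measurable]: "Z \<in> events"
      unfolding Z_def eventually_sequentially by measurable
    have bound: "prob Z \<le> 2 * e / c" if e: "0 < e" for e
    proof -
      obtain m h where h: "integrable M h" "h \<in> borel_measurable (F m)"
        and dist: "expectation (\<lambda>x. \<bar>f x - h x\<bar>) < e"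
        using approx e unfolding L1_approximable_def by blast
      let ?u = "\<lambda>x. \<bar>f x - h x\<bar>"
      have u: "integrable M ?u" and fh: "integrable M (\<lambda>x. f x - h x)"
        using f h by auto
      note [measurable] = borel_measurable_integrable[OF u]
      have "AE x in M. \<forall>n\<ge>m. \<bar>?E n f x - f x\<bar> \<le> ?E n ?u x + ?u x"
        unfolding AE_all_countable
      proof (intro allI AE_impI)
        fix n assume "m \<le> n"
        then have "subalgebra (F n) (F m)"
          using mono subalg[of n] subalg[of m] by (auto simp: subalgebra_def)
        then have h_n: "h \<in> borel_measurable (F n)"
          using h(2) by (rule measurable_from_subalg)
        have "AE x in M. ?E n (\<lambda>x. - (f x - h x)) x = - ?E n (\<lambda>x. f x - h x) x"
          using F.real_cond_exp_cmult[OF fh, of n "-1"] by simp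
        moreover have "AE x in M. ?E n (\<lambda>x. f x - h x) x \<le> ?E n ?u x"
          by (rule F.real_cond_exp_mono[OF _ fh u]) auto
        moreover have "AE x in M. ?E n (\<lambda>x. - (f x - h x)) x \<le> ?E n ?u x"
          by (rule F.real_cond_exp_mono[OF _ integrable_minus[OF fh] u]) auto
        moreover have "AE x in M. ?E n (\<lambda>x. f x - h x) x = ?E n f x - ?E n h x"
          by (rule F.real_cond_exp_diff[OF f h(1)])
        moreover have "AE x in M. ?E n h x = h x"
          by (rule F.real_cond_exp_F_meas[OF h(1) h_n])
        ultimately show "AE x in M. \<bar>?E n f x - f x\<bar> \<le> ?E n ?u x + ?u x"
          by eventually_elim linarith
      qed
      moreover have "\<exists>n\<ge>m. 2 * c < \<bar>?E n f x - f x\<bar>" if "x \<in> Z" for x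
        using that cd by (force simp: Z_def eventually_sequentially not_less)
      ultimately have "AE x in M. x \<in> Z \<longrightarrow>
          x \<in> {x \<in> space M. \<exists>n. c < ?E n ?u x} \<union> {x \<in> space M. c \<le> ?u x}"
      proof (elim AE_mp, intro AE_I2 impI)
        fix x assume x: "x \<in> space M" "\<forall>n\<ge>m. \<bar>?E n f x - f x\<bar> \<le> ?E n ?u x + ?u x" "x \<in> Z"
          and Z: "\<And>x. x \<in> Z \<Longrightarrow> \<exists>n\<ge>m. 2 * c < \<bar>?E n f x - f x\<bar>"
        obtain n where "n \<ge> m" "2 * c < \<bar>?E n f x - f x\<bar>"
          using Z[OF x(3)] by blast
        then have "2 * c < ?E n ?u x + ?u x"
          using x(2) by force
        then have "c < ?E n ?u x \<or> c \<le> ?u x"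
          by linarith
        then show "x \<in> {x \<in> space M. \<exists>n. c < ?E n ?u x} \<union> {x \<in> space M. c \<le> ?u x}"
          using x(1) by blast
      qed
      then have "prob Z \<le> prob ({x \<in> space M. \<exists>n. c < ?E n ?u x} \<union> {x \<in> space M. c \<le> ?u x})"
        by (rule finite_measure_mono_AE) measurable
      also have "\<dots> \<le> prob {x \<in> space M. \<exists>n. c < ?E n ?u x} + prob {x \<in> space M. c \<le> ?u x}"
        by (rule measure_Un_le) measurable
      also have "\<dots> \<le> expectation ?u / c + expectation ?u / c"
        using c u by (intro add_mono doob_maximal_inequality subalg mono
            integral_Markov_inequality_measure[where A = "{}"]) auto
      also have "\<dots> \<le> 2 * e / c"
        using dist c by (simp add: field_simps)
      finally show ?thesis .
    qed
    have "prob Z \<le> 0 + r" if r: "0 < r" for r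
      using bound[of "r * c / 2"] c r by simp
    then have "prob Z \<le> 0"
      by (rule field_le_epsilon)
    then have "AE x in M. x \<notin> Z"
      by (intro AE_not_in) (simp add: emeasure_eq_measure measure_le_0_iff null_sets_def)
    then show ?thesis
      by (rule AE_mp) (auto simp: Z_def)
  qed
  then show ?thesis
    unfolding LIMSEQ_iff_inverse_Suc AE_all_countable by simp
qed

section \<open>The strong law of large numbers for bounded functions\<close>

text \<open>Hoeffding's inequality makes the probabilities of a deviation by \<open>e\<close> decay geometrically,
  so Borel-Cantelli applies.\<close>

lemma strong_law_bounded:
  fixes f :: "'a \<Rightarrow> real"
  assumes M: "prob_space M" and f: "f \<in> borel_measurable M"
    and range: "\<And>x. x \<in> space M \<Longrightarrow> f x \<in> {a..b}" and "a < b"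
  shows "AE x in (\<Pi>\<^sub>M i\<in>(UNIV :: nat set). M). (\<lambda>n. (\<Sum>i<n. f (x i)) / n) \<longlonglongrightarrow> integral\<^sup>L M f"
proof -
  interpret M: prob_space M by (rule M)
  interpret product_prob_space "\<lambda>_::nat. M" UNIV
    by unfold_locales
  let ?N = "\<Pi>\<^sub>M i\<in>(UNIV :: nat set). M"
  let ?Y = "\<lambda>i x. f (x i)"
  note [measurable] = f
  have mean: "(\<integral>x. f (x 0) \<partial>?N) = integral\<^sup>L M f"
    by (subst PiM_component[of 0, symmetric], simp, subst integral_distr) auto
  have "P.indep_vars (\<lambda>_. M) (\<lambda>i x. x i) UNIV"
    by (subst P.indep_vars_iff_distr_eq_PiM')
      (simp_all add: PiM_component distr_id2 restrict_UNIV)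
  then have indep: "P.indep_vars (\<lambda>_. borel) ?Y UNIV"
    by (rule P.indep_vars_compose2) (rule f)
  have distr: "distr ?N borel (?Y i) = distr ?N borel (?Y 0)" for i
  proof -
    have "distr ?N borel (?Y j) = distr M borel f" for j
      by (subst (2) PiM_component[of j, symmetric], simp, subst distr_distr) (auto simp: comp_def)
    then show ?thesis by simp
  qed
  have "AE x in ?N. eventually (\<lambda>n. \<bar>(\<Sum>i<n. f (x i)) / n - integral\<^sup>L M f\<bar> < e) sequentially"
    if e: "0 < e" for e
  proof -
    let ?A = "\<lambda>n. {x \<in> space ?N. e \<le> \<bar>(\<Sum>i<n. f (x i)) / n - integral\<^sup>L M f\<bar>}"
    define q where "q = exp (- 2 * e\<^sup>2 / (b - a)\<^sup>2)"
    have q: "0 < q" "q < 1"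
      using e \<open>a < b\<close> by (auto simp: q_def)
    have "P.prob (?A n) \<le> 2 * q ^ n" if n: "0 < n" for n
    proof -
      interpret H: Hoeffding_ineq_iid ?N "{..<n}" ?Y "?Y 0" a b "integral\<^sup>L M f"
      proof unfold_locales
        show "P.indep_vars (\<lambda>_. borel) ?Y {..<n}"
          by (rule P.indep_vars_subset[OF indep]) simp
        show "distr ?N borel (?Y i) = distr ?N borel (?Y 0)" for i
          by (rule distr)
        show "AE x in ?N. ?Y 0 x \<in> {a..b}"
          using range by (intro AE_I2) (auto simp: space_PiM)
        show "integral\<^sup>L M f \<equiv> P.expectation (?Y 0)"
          unfolding mean .
      qed auto
      have "P.prob (?A n) \<le> 2 * exp (- 2 * real n * e\<^sup>2 / (b - a)\<^sup>2)"
        using H.Hoeffding_ineq_abs_ge'[of e] e \<open>a < b\<close> n by (simp add: lessThan_empty_iff)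
      also have "\<dots> = 2 * q ^ n"
        by (simp add: q_def exp_of_nat_mult[symmetric] mult_ac)
      finally show ?thesis .
    qed
    then have "summable (\<lambda>n. P.prob (?A n))"
      using q by (intro summable_comparison_test_ev[OF _ summable_mult[OF summable_geometric[of q], of 2]])
        (auto simp: eventually_sequentially intro!: exI[of _ 1])
    then have "AE x in ?N. eventually (\<lambda>n. x \<in> space ?N - ?A n) sequentially"
      by (intro borel_cantelli_AE1) (auto simp: P.emeasure_eq_measure)
    then show ?thesis
      by (rule AE_mp) (auto intro!: AE_I2 elim!: eventually_mono)
  qed
  then show ?thesis
    unfolding LIMSEQ_iff_inverse_Suc AE_all_countable by simp
qed

section \<open>Lusin's theorem and measurable injections\<close>

text \<open>Inner regularity is known for finite Borel measures on the whole Polish space; it passes to a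
  Borel subset \<open>S\<close> because compact subsets of \<open>S\<close> do not depend on the ambient space.\<close>

lemma inner_regular_restrict:
  fixes M :: "'b::polish_space measure"
  assumes M: "finite_measure M" and sets_M: "sets M = sets (restrict_space borel S)"
    and S: "S \<in> sets borel" and X: "X \<in> sets M" and "0 < e"
  obtains K where "K \<subseteq> X" "compact K" "K \<in> sets M" "measure M (X - K) < e"
proof -
  interpret finite_measure M by (rule M)
  let ?M = "distr M borel (\<lambda>x. x)"
  have space_M: "space M = S"
    using sets_eq_imp_space_eq[OF sets_M] by (simp add: space_restrict_space)
  have id: "(\<lambda>x. x) \<in> M \<rightarrow>\<^sub>M borel"
    unfolding measurable_cong_sets[OF sets_M refl] by (intro measurable_restrict_space1) simp
  have sets_eq: "Y \<in> sets M \<longleftrightarrow> Y \<in> sets borel \<and> Y \<subseteq> S" for Y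
    using S by (simp add: sets_M sets_restrict_space_iff conj_commute)
  have distr: "emeasure ?M Y = measure M Y" if "Y \<in> sets M" for Y
    using that space_M by (simp add: emeasure_distr[OF id] sets_eq Int_absorb2 emeasure_eq_measure)
  have fin: "emeasure ?M (space ?M) \<noteq> \<infinity>"
    by (simp add: emeasure_distr[OF id] emeasure_eq_measure)
  have reg: "emeasure ?M X = (SUP K\<in>{K. K \<subseteq> X \<and> compact K}. emeasure ?M K)"
    using X by (intro inner_regular fin) (simp_all add: sets_eq)
  obtain K where K: "K \<subseteq> X" "compact K" and less: "measure M X - e < measure M K"
  proof (cases "measure M X < e")
    case True
    then show ?thesis using that[of "{}"] by simp
  next
    case False
    then have "ennreal (measure M X - e) < emeasure ?M X"
      using \<open>0 < e\<close> by (simp add: distr[OF X] ennreal_less_iff)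
    then obtain K where K: "K \<subseteq> X" "compact K" "ennreal (measure M X - e) < emeasure ?M K"
      unfolding reg less_SUP_iff by auto
    then have "K \<in> sets M"
      using X by (auto simp: sets_eq intro: borel_compact)
    then show ?thesis
      using K False that[of K] by (simp add: distr ennreal_less_iff)
  qed
  have "K \<in> sets M"
    using X K by (auto simp: sets_eq intro: borel_compact)
  moreover have "measure M (X - K) < e"
    using less finite_measure_Diff[OF X \<open>K \<in> sets M\<close> K(1)] by simp
  ultimately show ?thesis
    using that K by blast
qed

text \<open>For each member \<open>U n\<close> of a countable basis of the target, the part of \<open>D\<close> mapped into \<open>U n\<close>
  and the part mapped outside are exhausted by compact sets \<open>C n\<close> and \<open>C' n\<close> up to a geometrically
  small error. On \<open>K\<close>, the intersection of all \<open>C n \<union> C' n\<close>, the preimage of \<open>U n\<close> is the complement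
  of the closed set \<open>C' n\<close>, hence relatively open.\<close>

lemma lusin:
  fixes M :: "'b::polish_space measure" and F :: "'b \<Rightarrow> 'c::second_countable_topology"
  assumes M: "finite_measure M" and sets_M: "sets M = sets (restrict_space borel S)"
    and S: "S \<in> sets borel" and F: "F \<in> borel_measurable M"
    and D: "D \<in> sets M" and e: "0 < e"
  obtains K where "K \<subseteq> D" "compact K" "K \<in> sets M" "continuous_on K F" "measure M (D - K) \<le> e"
proof -
  interpret finite_measure M by (rule M)
  obtain \<B> :: "'c set set" where \<B>: "countable \<B>" "topological_basis \<B>"
    using ex_countable_basis by blast
  \<comment> \<open>Enumerating by \<^const>\<open>from_nat_into\<close> takes a nonempty set, hence the extra member.\<close>
  define U where "U = from_nat_into (insert {} \<B>)"
  have U_range: "range U = insert {} \<B>"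
    using \<B>(1) by (simp add: U_def range_from_nat_into)
  have U_open: "open (U n)" for n
    using U_range \<B>(2) topological_basis_open by (metis insertE open_empty rangeI)
  have pre: "D \<inter> F -` U n \<in> sets M" for n
  proof -
    have "F -` U n \<inter> space M \<in> sets M"
      using U_open by (intro measurable_sets[OF F]) simp
    moreover have "D \<inter> F -` U n = D \<inter> (F -` U n \<inter> space M)"
      using sets.sets_into_space[OF D] by blast
    ultimately show ?thesis
      using D by (simp add: sets.Int)
  qed
  \<comment> \<open>There are two compact sets for each \<open>n\<close>, hence the extra factor of one half.\<close>
  define d where "d n = e * (1 / 2) ^ Suc n / 2" for n
  have d: "0 < d n" for n
    using e by (simp add: d_def)
  have "\<exists>C. C \<subseteq> D \<inter> F -` U n \<and> compact C \<and> C \<in> sets M \<and> measure M (D \<inter> F -` U n - C) < d n" for n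
    by (rule inner_regular_restrict[OF M sets_M S pre d]) blast
  then obtain C where C: "C n \<subseteq> D \<inter> F -` U n" "compact (C n)" "C n \<in> sets M"
    "measure M (D \<inter> F -` U n - C n) < d n" for n
    by metis
  have "\<exists>C. C \<subseteq> D - (D \<inter> F -` U n) \<and> compact C \<and> C \<in> sets M
      \<and> measure M (D - (D \<inter> F -` U n) - C) < d n" for n
    by (rule inner_regular_restrict[OF M sets_M S sets.Diff[OF D pre] d]) blast
  then obtain C' where C': "C' n \<subseteq> D - (D \<inter> F -` U n)" "compact (C' n)" "C' n \<in> sets M"
    "measure M (D - (D \<inter> F -` U n) - C' n) < d n" for n
    by metis
  define K where "K = (\<Inter>n. C n \<union> C' n)"
  have K_D: "K \<subseteq> D"
    using C(1)[of 0] C'(1)[of 0] by (auto simp: K_def)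
  have "closed K"
    unfolding K_def using C(2) C'(2) by (intro closed_INT ballI closed_Un compact_imp_closed)
  then have "compact ((C 0 \<union> C' 0) \<inter> K)"
    using C(2) C'(2) by (intro compact_Int_closed compact_Un)
  moreover have "(C 0 \<union> C' 0) \<inter> K = K"
    by (auto simp: K_def)
  ultimately have "compact K"
    by simp
  moreover have K_sets: "K \<in> sets M"
    unfolding K_def using C(3) C'(3) by (intro sets.countable_INT) auto
  moreover have "continuous_on K F"
    unfolding continuous_on_topological
  proof (intro ballI allI impI)
    fix x V assume x: "x \<in> K" and V: "open V" "F x \<in> V"
    obtain W where "W \<in> \<B>" "F x \<in> W" "W \<subseteq> V"
      using topological_basisE[OF \<B>(2) V] by blast
    then obtain n where n: "F x \<in> U n" "U n \<subseteq> V"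
      using U_range by (metis insertI2 rangeE)
    have "x \<in> - C' n"
      using n C'(1)[of n] by blast
    moreover have "F y \<in> V" if "y \<in> K" "y \<in> - C' n" for y
      using that n C(1)[of n] by (auto simp: K_def)
    ultimately show "\<exists>A. open A \<and> x \<in> A \<and> (\<forall>y\<in>K. y \<in> A \<longrightarrow> F y \<in> V)"
      using compact_imp_closed[OF C'(2)[of n]] by (intro exI[of _ "- C' n"]) auto
  qed
  moreover have "measure M (D - K) \<le> e"
  proof -
    let ?R = "\<lambda>n. D - (C n \<union> C' n)"
    have R: "measure M (?R n) \<le> e * (1 / 2) ^ Suc n" for n
    proof -
      have "measure M (?R n) \<le> measure M ((D \<inter> F -` U n - C n) \<union> (D - (D \<inter> F -` U n) - C' n))"
        using D pre C(3) C'(3) by (intro finite_measure_mono) auto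
      also have "\<dots> \<le> measure M (D \<inter> F -` U n - C n) + measure M (D - (D \<inter> F -` U n) - C' n)"
        using D pre C(3) C'(3) by (intro measure_Un_le) auto
      also have "\<dots> \<le> e * (1 / 2) ^ Suc n"
        using C(4)[of n] C'(4)[of n] by (simp add: d_def)
      finally show ?thesis .
    qed
    have sums: "(\<lambda>n. e * (1 / 2) ^ Suc n) sums e"
      using sums_mult[OF power_half_series, of e] by simp
    have summable: "summable (\<lambda>n. measure M (?R n))"
      by (rule summable_comparison_test'[OF sums_summable[OF sums], of 0]) (use R in simp)
    have "D - K = (\<Union>n. ?R n)"
      by (auto simp: K_def)
    also have "measure M \<dots> \<le> (\<Sum>n. measure M (?R n))"
      using D C(3) C'(3) summable by (intro finite_measure_subadditive_countably) auto
    also have "\<dots> \<le> e"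
      using suminf_le[OF R summable sums_summable[OF sums]] sums_unique[OF sums] by simp
    finally show ?thesis .
  qed
  ultimately show ?thesis
    using that K_D by blast
qed

text \<open>A measurable injection loses no information up to null sets: every event is nearly a continuous
  function of \<open>F\<close>. If \<open>K\<close> is a compact subset of \<open>D\<close>, of almost full measure, on which \<open>F\<close> is continuous,
  then \<open>F ` K\<close> is closed, and by injectivity its preimage is \<open>K\<close> exactly. So \<open>indicator K\<close> is the
  limit of steepening tent functions of the distance from \<open>F \<theta>\<close> to \<open>F ` K\<close>. This replaces the
  Lusin-Souslin theorem on injective Borel images.\<close>

lemma indicator_approx_by_continuous_of_injection:
  fixes M :: "'b::polish_space measure" and F :: "'b \<Rightarrow> 'c::{metric_space, second_countable_topology}"
  assumes M: "finite_measure M" and sets_M: "sets M = sets (restrict_space borel S)"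
    and S: "S \<in> sets borel" and F: "F \<in> borel_measurable M" and inj: "inj_on F (space M)"
    and D: "D \<in> sets M" and e: "0 < e"
  obtains \<phi> :: "'c \<Rightarrow> real" where "continuous_on UNIV \<phi>" "\<And>y. 0 \<le> \<phi> y \<and> \<phi> y \<le> 1"
    "(\<integral>\<theta>. \<bar>indicator D \<theta> - \<phi> (F \<theta>)\<bar> \<partial>M) < e"
proof -
  interpret finite_measure M by (rule M)
  obtain K where K: "K \<subseteq> D" "compact K" "K \<in> sets M" "continuous_on K F"
    and small: "measure M (D - K) \<le> e / 2"
    using lusin[OF M sets_M S F D, of "e / 2"] e by auto
  have "compact (F ` K)"
    using K(2,4) by (intro compact_continuous_image)
  then have closed: "closed (F ` K)"
    by (rule compact_imp_closed)
  have K_space: "K \<subseteq> space M"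
    using K(3) by (rule sets.sets_into_space)
  have rest: "(\<integral>\<theta>. \<bar>indicator D \<theta> - indicator K \<theta> :: real\<bar> \<partial>M) \<le> e / 2"
  proof -
    have "(\<integral>\<theta>. \<bar>indicator D \<theta> - indicator K \<theta> :: real\<bar> \<partial>M) = (\<integral>\<theta>. indicator (D - K) \<theta> \<partial>M)"
      using K(1) by (intro Bochner_Integration.integral_cong) (auto simp: indicator_def)
    also have "\<dots> = measure M (D - K)"
      using D K(3) by (simp add: Int_absorb2 sets.sets_into_space sets.Diff)
    finally show ?thesis
      using small by simp
  qed
  \<comment> \<open>The empty set is treated apart, since \<^const>\<open>infdist\<close> to it is \<open>0\<close> by convention.\<close>
  show ?thesis
  proof (cases "K = {}")
    case True
    then show ?thesis
      using rest e by (intro that[of "\<lambda>_. 0"]) (auto simp: indicator_def)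
  next
    case False
    define \<phi> where "\<phi> j y = max 0 (1 - real j * infdist y (F ` K))" for j y
    have cont: "continuous_on UNIV (\<phi> j)" for j
      unfolding \<phi>_def by (intro continuous_intros)
    have bounds: "0 \<le> \<phi> j y \<and> \<phi> j y \<le> 1" for j y
      by (simp add: \<phi>_def infdist_nonneg)
    have meas: "(\<lambda>\<theta>. \<phi> j (F \<theta>)) \<in> borel_measurable M" for j
      by (rule measurable_compose[OF F borel_measurable_continuous_onI[OF cont]])
    have lim: "(\<lambda>j. \<phi> j (F \<theta>)) \<longlonglongrightarrow> indicator K \<theta>" if \<theta>: "\<theta> \<in> space M" for \<theta>
    proof (cases "\<theta> \<in> K")
      case True
      then show ?thesis by (simp add: \<phi>_def)
    next
      case notin: False
      then have "F \<theta> \<notin> F ` K"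
        using inj \<theta> K_space by (auto dest: inj_onD)
      then have pos: "0 < infdist (F \<theta>) (F ` K)"
        using infdist_pos_not_in_closed[OF closed] False by simp
      obtain n where n: "1 < real n * infdist (F \<theta>) (F ` K)"
        using reals_Archimedean3[OF pos] by blast
      have "\<phi> j (F \<theta>) = 0" if "n \<le> j" for j
      proof -
        have "real n * infdist (F \<theta>) (F ` K) \<le> real j * infdist (F \<theta>) (F ` K)"
          using that pos by (intro mult_right_mono) auto
        then show ?thesis
          using n unfolding \<phi>_def by linarith
      qed
      then have "eventually (\<lambda>j. \<phi> j (F \<theta>) = 0) sequentially"
        by (auto simp: eventually_sequentially)
      then show ?thesis
        using notin by (simp add: tendsto_eventually)
    qed
    have "(\<lambda>j. \<integral>\<theta>. \<bar>indicator D \<theta> - \<phi> j (F \<theta>)\<bar> \<partial>M) \<longlonglongrightarrow> (\<integral>\<theta>. \<bar>indicator D \<theta> - indicator K \<theta> :: real\<bar> \<partial>M)"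
    proof (rule integral_dominated_convergence[where w = "\<lambda>_. 1"])
      show "(\<lambda>\<theta>. \<bar>indicator D \<theta> - indicator K \<theta> :: real\<bar>) \<in> borel_measurable M"
        using D K(3) by measurable
      show "(\<lambda>\<theta>. \<bar>indicator D \<theta> - \<phi> j (F \<theta>)\<bar>) \<in> borel_measurable M" for j
        using D meas by measurable
      show "AE \<theta> in M. (\<lambda>j. \<bar>indicator D \<theta> - \<phi> j (F \<theta>)\<bar>) \<longlonglongrightarrow> \<bar>indicator D \<theta> - indicator K \<theta> :: real\<bar>"
        by (intro AE_I2 tendsto_intros lim)
      show "AE \<theta> in M. norm \<bar>indicator D \<theta> - \<phi> j (F \<theta>)\<bar> \<le> 1" for j
      proof (intro AE_I2)
        fix \<theta>
        show "norm \<bar>indicator D \<theta> - \<phi> j (F \<theta>)\<bar> \<le> 1"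
          using bounds[of j "F \<theta>"] by (simp add: indicator_def abs_le_iff)
      qed
    qed simp
    then have "eventually (\<lambda>j. (\<integral>\<theta>. \<bar>indicator D \<theta> - \<phi> j (F \<theta>)\<bar> \<partial>M) < e) sequentially"
      by (rule order_tendstoD(2)) (use rest e in linarith)
    then obtain j where "(\<integral>\<theta>. \<bar>indicator D \<theta> - \<phi> j (F \<theta>)\<bar> \<partial>M) < e"
      by (auto simp: eventually_sequentially)
    then show ?thesis
      using that[of "\<phi> j"] cont bounds by blast
  qed
qed

section \<open>Countable families of sets that determine a measure\<close>

text \<open>The finite intersections of members of a countable basis form a countable generator that is
  closed under intersection. Indexing them by codes of finite lists makes them a sequence.\<close>

lemma ex_countable_measure_determining:
  obtains B :: "nat \<Rightarrow> 'a::second_countable_topology set"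
  where "\<And>n. B n \<in> sets borel"
    "\<And>M N :: 'a measure. \<lbrakk>finite_measure M; sets M = sets borel; sets N = sets borel;
      \<And>n. emeasure M (B n) = emeasure N (B n)\<rbrakk> \<Longrightarrow> M = N"
proof -
  obtain \<B> :: "'a set set" where \<B>: "countable \<B>" "topological_basis \<B>"
    using ex_countable_basis by blast
  \<comment> \<open>Enumerating by \<^const>\<open>from_nat_into\<close> takes a nonempty set, hence the extra member.\<close>
  define U where "U = from_nat_into (insert {} \<B>)"
  have U_range: "range U = insert {} \<B>"
    using \<B>(1) by (simp add: U_def range_from_nat_into)
  define B where "B n = (\<Inter>i\<in>set (from_nat n :: nat list). U i)" for n
  have B_list: "B (to_nat is) = (\<Inter>i\<in>set is. U i)" for "is"
    by (simp add: B_def)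
  have U_open: "open (U n)" for n
    using U_range \<B>(2) topological_basis_open by (metis insertE open_empty rangeI)
  have B_borel: "B n \<in> sets borel" for n
    using U_open by (auto simp: B_def intro!: borel_open)
  have stable: "Int_stable (range B)"
  proof (rule Int_stableI, elim rangeE)
    fix a b m n assume "a = B m" "b = B n"
    then have "a \<inter> b = B (to_nat ((from_nat m :: nat list) @ from_nat n))"
      unfolding B_list by (auto simp: B_def)
    then show "a \<inter> b \<in> range B"
      by simp
  qed
  have UNIV_B: "UNIV \<in> range B"
    using rangeI[of B "to_nat ([] :: nat list)"] by (simp add: B_list)
  have sigma: "sets borel = sigma_sets UNIV (range B)"
  proof
    have "U i \<in> range B" for i
      using rangeI[of B "to_nat [i]"] by (simp add: B_list)
    then have "range U \<subseteq> range B"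
      by (rule image_subsetI)
    then have "\<B> \<subseteq> range B"
      unfolding U_range by simp
    moreover have "sets borel = sigma_sets UNIV \<B>"
      by (simp add: borel_eq_countable_basis[OF \<B>])
    ultimately show "sets borel \<subseteq> sigma_sets UNIV (range B)"
      by (simp add: sigma_sets_mono')
    show "sigma_sets UNIV (range B) \<subseteq> sets borel"
      using B_borel sets.sigma_sets_subset[of "range B" borel] by auto
  qed
  show ?thesis
  proof (rule that[OF B_borel])
    fix M N :: "'a measure"
    assume M: "finite_measure M" "sets M = sets borel" and N: "sets N = sets borel"
      and eq: "\<And>n. emeasure M (B n) = emeasure N (B n)"
    show "M = N"
    proof (rule measure_eqI_generator_eq[OF stable, of UNIV _ _ "\<lambda>_. UNIV"])
      show "emeasure M X = emeasure N X" if "X \<in> range B" for X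
        using that eq by auto
      show "emeasure M UNIV \<noteq> \<infinity>" for i :: nat
        using finite_measure.emeasure_finite[OF M(1)] by (simp add: top.not_eq_extremum)
      show "range (\<lambda>_::nat. UNIV) \<subseteq> range B"
        using UNIV_B by blast
      show "sets M = sigma_sets UNIV (range B)" "sets N = sigma_sets UNIV (range B)"
        unfolding M(2) N by (rule sigma)+
    qed auto
  qed
qed

text \<open>Push the measures forward to the whole space, where the previous lemma applies.\<close>

lemma identifiable_imp_countably_identifiable:
  fixes P :: "'b \<Rightarrow> 'a::second_countable_topology measure"
  assumes X: "X \<in> sets borel"
    and prob: "\<And>\<theta>. \<theta> \<in> S \<Longrightarrow> prob_space (P \<theta>)"
    and sets_P: "\<And>\<theta>. \<theta> \<in> S \<Longrightarrow> sets (P \<theta>) = sets (restrict_space borel X)"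
    and inj: "inj_on P S"
  shows "\<exists>B :: nat \<Rightarrow> 'a set. (\<forall>k. B k \<in> sets (restrict_space borel X)) \<and>
    inj_on (\<lambda>\<theta> k. measure (P \<theta>) (B k)) S"
proof -
  obtain C :: "nat \<Rightarrow> 'a set" where C: "\<And>n. C n \<in> sets borel"
    "\<And>M N :: 'a measure. \<lbrakk>finite_measure M; sets M = sets borel; sets N = sets borel;
      \<And>n. emeasure M (C n) = emeasure N (C n)\<rbrakk> \<Longrightarrow> M = N"
    by (rule ex_countable_measure_determining) blast
  let ?Q = "\<lambda>\<theta>. distr (P \<theta>) borel (\<lambda>x. x)"
  have id: "(\<lambda>x. x) \<in> P \<theta> \<rightarrow>\<^sub>M borel" if "\<theta> \<in> S" for \<theta>
    unfolding measurable_cong_sets[OF sets_P[OF that] refl] by (intro measurable_restrict_space1) simp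
  have space_P: "space (P \<theta>) = X" if "\<theta> \<in> S" for \<theta>
    using sets_eq_imp_space_eq[OF sets_P[OF that]] by (simp add: space_restrict_space)
  have Q: "emeasure (?Q \<theta>) Y = measure (P \<theta>) (Y \<inter> X)" if "\<theta> \<in> S" "Y \<in> sets borel" for \<theta> Y
    using that finite_measure.emeasure_eq_measure[OF prob_space.finite_measure[OF prob]]
    by (simp add: emeasure_distr[OF id] space_P)
  show ?thesis
  proof (intro exI[of _ "\<lambda>k. C k \<inter> X"] conjI allI)
    show "C k \<inter> X \<in> sets (restrict_space borel X)" for k
      using C(1) X by (auto simp: sets_restrict_space_iff)
    show "inj_on (\<lambda>\<theta> k. measure (P \<theta>) (C k \<inter> X)) S"
    proof (rule inj_onI)
      fix \<theta> \<theta>' assume \<theta>: "\<theta> \<in> S" "\<theta>' \<in> S"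
        and eq: "(\<lambda>k. measure (P \<theta>) (C k \<inter> X)) = (\<lambda>k. measure (P \<theta>') (C k \<inter> X))"
      have Q_eq: "?Q \<theta> = ?Q \<theta>'"
      proof (rule C(2))
        show "finite_measure (?Q \<theta>)"
          by (intro finite_measure.finite_measure_distr[OF prob_space.finite_measure[OF prob[OF \<theta>(1)]]] id \<theta>)
        show "emeasure (?Q \<theta>) (C n) = emeasure (?Q \<theta>') (C n)" for n
          using fun_cong[OF eq, of n] by (simp add: Q \<theta> C(1))
      qed simp_all
      have "P \<theta> = P \<theta>'"
      proof (rule measure_eqI)
        fix Y assume "Y \<in> sets (P \<theta>)"
        then have Y: "Y \<in> sets borel" "Y \<inter> X = Y" "Y \<in> sets (P \<theta>')"
          using X \<theta> by (auto simp: sets_P sets_restrict_space_iff)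
        have "emeasure (P \<theta>) Y = emeasure (?Q \<theta>) Y"
          using Y \<theta> by (simp add: emeasure_distr[OF id] space_P)
        also have "\<dots> = emeasure (P \<theta>') Y"
          unfolding Q_eq using Y \<theta> by (simp add: emeasure_distr[OF id] space_P)
        finally show "emeasure (P \<theta>) Y = emeasure (P \<theta>') Y" .
      qed (simp add: sets_P \<theta>)
      then show "\<theta> = \<theta>'"
        using inj \<theta> by (auto dest: inj_onD)
    qed
  qed
qed

section \<open>The i.i.d. model with a random parameter\<close>

lemma tendsto_funI:
  fixes X :: "'c \<Rightarrow> 'i \<Rightarrow> 'd::topological_space"
  assumes "\<And>i. ((\<lambda>n. X n i) \<longlongrightarrow> L i) F"
  shows "(X \<longlongrightarrow> L) F"
proof -
  have "limitin (product_topology (\<lambda>_. euclidean) UNIV) X L F"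
    unfolding limitin_componentwise using assms by simp
  then show ?thesis
    by (simp add: euclidean_product_topology)
qed

locale iid_model =
  fixes A :: "'a measure" and P :: "'b \<Rightarrow> 'a measure" and \<pi> :: "'b measure"
  assumes prob_prior: "prob_space \<pi>"
    and prob_P: "\<And>\<theta>. \<theta> \<in> space \<pi> \<Longrightarrow> prob_space (P \<theta>)"
    and sets_P: "\<And>\<theta>. \<theta> \<in> space \<pi> \<Longrightarrow> sets (P \<theta>) = sets A"
    and measurable_P: "\<And>B. B \<in> sets A \<Longrightarrow> (\<lambda>\<theta>. measure (P \<theta>) B) \<in> borel_measurable \<pi>"
begin

abbreviation "\<mu> \<equiv> iid_joint A P \<pi>"

abbreviation "obs \<equiv> obs_algebra A \<mu>"

lemma emeasure_joint:
  "E \<in> sets \<mu> \<Longrightarrow> emeasure \<mu> E = (\<integral>\<^sup>+\<theta>. emeasure (\<Pi>\<^sub>M i\<in>UNIV. P \<theta>) ((\<lambda>x. (x, \<theta>)) -` E) \<partial>\<pi>)"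
  using emeasure_iid_joint[OF prob_P sets_P measurable_P, of E] by simp

lemma space_PiM_P:
  "\<theta> \<in> space \<pi> \<Longrightarrow> space (\<Pi>\<^sub>M i\<in>(UNIV :: nat set). P \<theta>) = space (\<Pi>\<^sub>M i\<in>(UNIV :: nat set). A)"
  using sets_eq_imp_space_eq[OF sets_P] by (simp add: space_PiM)

lemma prob_PiM_P: "\<theta> \<in> space \<pi> \<Longrightarrow> prob_space (\<Pi>\<^sub>M i\<in>(UNIV :: nat set). P \<theta>)"
  by (intro prob_space_PiM prob_P)

text \<open>The easy half of Fubini's theorem: what holds almost surely for every fixed parameter holds
  almost surely when the parameter is random.\<close>

lemma AE_jointI:
  assumes Q: "Measurable.pred \<mu> Q"
    and AE: "\<And>\<theta>. \<theta> \<in> space \<pi> \<Longrightarrow> AE x in (\<Pi>\<^sub>M i\<in>UNIV. P \<theta>). Q (x, \<theta>)"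
  shows "AE \<omega> in \<mu>. Q \<omega>"
proof -
  let ?N = "{\<omega> \<in> space \<mu>. \<not> Q \<omega>}"
  have N: "?N \<in> sets \<mu>"
    using Q by measurable
  have "emeasure (\<Pi>\<^sub>M i\<in>UNIV. P \<theta>) ((\<lambda>x. (x, \<theta>)) -` ?N) = 0" if \<theta>: "\<theta> \<in> space \<pi>" for \<theta>
  proof -
    have "(\<lambda>x. (x, \<theta>)) -` ?N = {x \<in> space (\<Pi>\<^sub>M i\<in>UNIV. P \<theta>). \<not> Q (x, \<theta>)}"
      using \<theta> by (auto simp: space_pair_measure space_PiM_P)
    then show ?thesis
      using AE[OF \<theta>] by (simp add: emeasure_eq_0_AE)
  qed
  then have "emeasure \<mu> ?N = (\<integral>\<^sup>+\<theta>. 0 \<partial>\<pi>)"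
    unfolding emeasure_joint[OF N] by (intro nn_integral_cong) simp
  then show ?thesis
    using N by (intro AE_I[where N = ?N]) auto
qed

lemma measurable_snd_joint: "snd \<in> \<mu> \<rightarrow>\<^sub>M \<pi>"
  by measurable

lemma distr_snd_joint: "distr \<mu> \<pi> snd = \<pi>"
proof (rule measure_eqI)
  fix D assume "D \<in> sets (distr \<mu> \<pi> snd)"
  then have D: "D \<in> sets \<pi>"
    by simp
  let ?E = "snd -` D \<inter> space \<mu>"
  have E: "?E \<in> sets \<mu>"
    using D by (rule measurable_sets[OF measurable_snd_joint])
  have "emeasure (\<Pi>\<^sub>M i\<in>UNIV. P \<theta>) ((\<lambda>x. (x, \<theta>)) -` ?E) = indicator D \<theta>" if \<theta>: "\<theta> \<in> space \<pi>" for \<theta>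
  proof -
    have "(\<lambda>x. (x, \<theta>)) -` ?E = (if \<theta> \<in> D then space (\<Pi>\<^sub>M i\<in>UNIV. P \<theta>) else {})"
      using \<theta> by (auto simp: space_pair_measure space_PiM_P)
    then show ?thesis
      using prob_space.emeasure_space_1[OF prob_PiM_P[OF \<theta>]] by simp
  qed
  then have "emeasure \<mu> ?E = (\<integral>\<^sup>+\<theta>. indicator D \<theta> \<partial>\<pi>)"
    unfolding emeasure_joint[OF E] by (intro nn_integral_cong)
  then show "emeasure (distr \<mu> \<pi> snd) D = emeasure \<pi> D"
    using D by (simp add: emeasure_distr[OF measurable_snd_joint])
qed simp

sublocale joint: prob_space \<mu>
proof (rule prob_space_distrD[OF measurable_snd_joint])
  show "prob_space (distr \<mu> \<pi> snd)"
    unfolding distr_snd_joint by (rule prob_prior)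
qed

lemma integral_joint_snd:
  fixes f :: "'b \<Rightarrow> real"
  assumes "f \<in> borel_measurable \<pi>"
  shows "(\<integral>\<omega>. f (snd \<omega>) \<partial>\<mu>) = (\<integral>\<theta>. f \<theta> \<partial>\<pi>)"
    "integrable \<mu> (\<lambda>\<omega>. f (snd \<omega>)) \<longleftrightarrow> integrable \<pi> f"
  using integral_distr[OF measurable_snd_joint assms] integrable_distr_eq[OF measurable_snd_joint assms]
  by (simp_all add: distr_snd_joint)

lemma space_obs: "space (obs n) = space \<mu>"
  by (simp add: obs_algebra_def)

lemma measurable_obs: "i < n \<Longrightarrow> (\<lambda>\<omega>. fst \<omega> i) \<in> obs n \<rightarrow>\<^sub>M A"
proof -
  assume i: "i < n"
  have "(\<lambda>\<omega>. restrict (fst \<omega>) {..<n}) \<in> obs n \<rightarrow>\<^sub>M (\<Pi>\<^sub>M i\<in>{..<n}. A)"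
    unfolding obs_algebra_def
    by (rule measurable_vimage_algebra1) (auto simp: space_pair_measure space_PiM PiE_iff split: if_splits)
  then have "(\<lambda>\<omega>. restrict (fst \<omega>) {..<n} i) \<in> obs n \<rightarrow>\<^sub>M A"
    by (rule measurable_compose[OF _ measurable_component_singleton]) (use i in simp)
  then show ?thesis
    using i by simp
qed

lemma obs_mono: "m \<le> n \<Longrightarrow> subalgebra (obs n) (obs m)"
proof -
  assume "m \<le> n"
  then have "(\<lambda>\<omega>. restrict (fst \<omega>) {..<m}) \<in> obs n \<rightarrow>\<^sub>M (\<Pi>\<^sub>M i\<in>{..<m}. A)"
    by (intro measurable_restrict measurable_obs) auto
  then have "sets (obs m) \<subseteq> sets (obs n)"
    unfolding obs_algebra_def[of A \<mu> m] by (intro sets_image_in_sets) (simp_all add: space_obs)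
  then show ?thesis
    by (simp add: subalgebra_def space_obs)
qed

lemma subalgebra_obs: "subalgebra \<mu> (obs n)"
  by (rule subalgebra_obs_algebra)

definition freq :: "'a set \<Rightarrow> nat \<Rightarrow> (nat \<Rightarrow> 'a) \<times> 'b \<Rightarrow> real" where
  "freq B n \<omega> = (\<Sum>i<n. indicator B (fst \<omega> i)) / n"

lemma measurable_freq_obs: "B \<in> sets A \<Longrightarrow> freq B n \<in> borel_measurable (obs n)"
  unfolding freq_def
  by (intro borel_measurable_divide borel_measurable_sum borel_measurable_const
      measurable_compose[OF measurable_obs borel_measurable_indicator]) auto

lemma measurable_freq [measurable]: "B \<in> sets A \<Longrightarrow> freq B n \<in> borel_measurable \<mu>"
  by (rule measurable_from_subalg[OF subalgebra_obs measurable_freq_obs])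

lemma measurable_P_joint: "B \<in> sets A \<Longrightarrow> (\<lambda>\<omega>. measure (P (snd \<omega>)) B) \<in> borel_measurable \<mu>"
  by (rule measurable_compose[OF measurable_snd_joint measurable_P])

text \<open>The strong law, applied for each fixed parameter.\<close>

lemma freq_tendsto:
  assumes B: "B \<in> sets A"
  shows "AE \<omega> in \<mu>. (\<lambda>n. freq B n \<omega>) \<longlonglongrightarrow> measure (P (snd \<omega>)) B"
proof (rule AE_jointI)
  note [measurable] = B measurable_P_joint[OF B]
  show "Measurable.pred \<mu> (\<lambda>\<omega>. (\<lambda>n. freq B n \<omega>) \<longlonglongrightarrow> measure (P (snd \<omega>)) B)"
    unfolding LIMSEQ_iff_inverse_Suc eventually_sequentially by measurable
  fix \<theta> assume \<theta>: "\<theta> \<in> space \<pi>"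
  then have B_\<theta>: "B \<in> sets (P \<theta>)"
    using B sets_P by simp
  have "AE x in (\<Pi>\<^sub>M i\<in>(UNIV :: nat set). P \<theta>).
      (\<lambda>n. (\<Sum>i<n. indicator B (x i)) / n) \<longlonglongrightarrow> integral\<^sup>L (P \<theta>) (indicator B)"
    using B_\<theta> by (intro strong_law_bounded[where a = 0 and b = 1] prob_P \<theta>) (auto simp: indicator_def)
  then show "AE x in (\<Pi>\<^sub>M i\<in>UNIV. P \<theta>). (\<lambda>n. freq B n (x, \<theta>)) \<longlonglongrightarrow> measure (P (snd (x, \<theta>))) B"
    using B_\<theta> sets.sets_into_space[OF B_\<theta>] by (simp add: freq_def Int_absorb2)
qed

text \<open>The probabilities \<open>P \<theta> (B k)\<close> are almost sure limits of observed relative frequencies, and a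
  continuous function on the product space respects the simultaneous limit over all \<open>k\<close>.\<close>

lemma L1_approximable_continuous_of_probabilities:
  fixes B :: "nat \<Rightarrow> 'a set" and \<phi> :: "(nat \<Rightarrow> real) \<Rightarrow> real"
  assumes B: "\<And>k. B k \<in> sets A"
    and cont: "continuous_on UNIV \<phi>" and bounds: "\<And>y. 0 \<le> \<phi> y \<and> \<phi> y \<le> 1"
  shows "L1_approximable \<mu> obs (\<lambda>\<omega>. \<phi> (\<lambda>k. measure (P (snd \<omega>)) (B k)))"
proof (rule L1_approximable_lim)
  let ?s = "\<lambda>n \<omega>. \<phi> (\<lambda>k. freq (B k) n \<omega>)"
  have \<phi>: "\<phi> \<in> borel_measurable borel"
    by (rule borel_measurable_continuous_onI[OF cont])
  have s_obs: "?s n \<in> borel_measurable (obs n)" for n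
    by (rule measurable_compose[OF _ \<phi>], rule measurable_coordinatewise_then_product)
      (rule measurable_freq_obs[OF B])
  show "L1_approximable \<mu> obs (?s n)" for n
  proof (rule L1_approximableI)
    show "integrable \<mu> (?s n)"
      using bounds by (intro joint.integrable_const_bound[where B = 1]
          measurable_from_subalg[OF subalgebra_obs s_obs]) auto
  qed (rule s_obs)
  show "(\<lambda>\<omega>. \<phi> (\<lambda>k. measure (P (snd \<omega>)) (B k))) \<in> borel_measurable \<mu>"
    by (rule measurable_compose[OF _ \<phi>], rule measurable_coordinatewise_then_product)
      (rule measurable_P_joint[OF B])
  have "AE \<omega> in \<mu>. \<forall>k. (\<lambda>n. freq (B k) n \<omega>) \<longlonglongrightarrow> measure (P (snd \<omega>)) (B k)"
    unfolding AE_all_countable by (intro allI freq_tendsto B)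
  then show "AE \<omega> in \<mu>. (\<lambda>n. ?s n \<omega>) \<longlonglongrightarrow> \<phi> (\<lambda>k. measure (P (snd \<omega>)) (B k))"
  proof eventually_elim
    case (elim \<omega>)
    then have "(\<lambda>n k. freq (B k) n \<omega>) \<longlonglongrightarrow> (\<lambda>k. measure (P (snd \<omega>)) (B k))"
      by (intro tendsto_funI) simp
    then show ?case
      by (rule continuous_on_tendsto_compose[OF cont]) auto
  qed
  show "integrable \<mu> (\<lambda>_. 1 :: real)"
    by simp
  show "\<bar>?s n \<omega>\<bar> \<le> 1" for n \<omega>
    using bounds by (simp add: abs_le_iff add_increasing2)
qed

end

section \<open>The observations determine the parameter\<close>

text \<open>The map that sends \<open>\<theta>\<close> to the sequence of probabilities \<open>P \<theta> (B k)\<close> is a measurable injection,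
  so events about \<open>\<theta>\<close> are approximated by continuous functions of that sequence, and these in turn
  by functions of finitely many observations. Integrable functions follow by linearity and limits.\<close>

lemma L1_approximable_parameter:
  fixes A :: "'a measure" and P :: "'b::polish_space \<Rightarrow> 'a measure" and B :: "nat \<Rightarrow> 'a set"
  assumes model: "iid_model A P \<pi>"
    and sets_\<pi>: "sets \<pi> = sets (restrict_space borel S)" and S: "S \<in> sets borel"
    and B: "\<And>k. B k \<in> sets A" and inj: "inj_on (\<lambda>\<theta> k. measure (P \<theta>) (B k)) (space \<pi>)"
    and g: "integrable \<pi> g"
  shows "L1_approximable (iid_joint A P \<pi>) (obs_algebra A (iid_joint A P \<pi>)) (\<lambda>\<omega>. g (snd \<omega>))"
proof -
  interpret iid_model A P \<pi>
    by (rule model)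
  interpret \<pi>: prob_space \<pi>
    by (rule prob_prior)
  let ?L = "\<lambda>\<theta> k. measure (P \<theta>) (B k)"
  have L: "?L \<in> borel_measurable \<pi>"
    by (rule measurable_coordinatewise_then_product) (rule measurable_P[OF B])
  have indicator: "L1_approximable \<mu> obs (\<lambda>\<omega>. indicator D (snd \<omega>))" if D: "D \<in> sets \<pi>" for D
  proof (rule L1_approximable_closed)
    show "integrable \<mu> (\<lambda>\<omega>. indicator D (snd \<omega>) :: real)"
      using D by (subst integral_joint_snd) (auto simp: \<pi>.emeasure_eq_measure)
    fix e :: real assume "0 < e"
    then obtain \<phi> where \<phi>: "continuous_on UNIV \<phi>" "\<And>y. 0 \<le> \<phi> y \<and> \<phi> y \<le> 1"
      and dist: "(\<integral>\<theta>. \<bar>indicator D \<theta> - \<phi> (?L \<theta>)\<bar> \<partial>\<pi>) < e"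
      using indicator_approx_by_continuous_of_injection[OF \<pi>.finite_measure_axioms sets_\<pi> S L inj D]
      by blast
    have "(\<lambda>\<theta>. \<phi> (?L \<theta>)) \<in> borel_measurable \<pi>"
      by (rule measurable_compose[OF L borel_measurable_continuous_onI[OF \<phi>(1)]])
    then have "(\<integral>\<omega>. \<bar>indicator D (snd \<omega>) - \<phi> (?L (snd \<omega>))\<bar> \<partial>\<mu>) = (\<integral>\<theta>. \<bar>indicator D \<theta> - \<phi> (?L \<theta>)\<bar> \<partial>\<pi>)"
      using D by (intro integral_joint_snd(1) borel_measurable_abs borel_measurable_diff borel_measurable_indicator)
    then show "\<exists>h. L1_approximable \<mu> obs h \<and> (\<integral>\<omega>. \<bar>indicator D (snd \<omega>) - h \<omega>\<bar> \<partial>\<mu>) < e"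
      using L1_approximable_continuous_of_probabilities[OF B \<phi>] dist
      by (intro exI[of _ "\<lambda>\<omega>. \<phi> (?L (snd \<omega>))"]) simp
  qed
  show ?thesis
    using g
  proof (induction rule: integrable_induct)
    case (base D c)
    show ?case
      using L1_approximable_cmult[OF indicator[OF base(1)], of c] by (simp add: mult.commute)
  next
    case (add f h)
    then show ?case
      by (intro L1_approximable_add obs_mono)
  next
    case (lim f s)
    show ?case
    proof (rule L1_approximable_lim[where w = "\<lambda>\<omega>. 2 * \<bar>f (snd \<omega>)\<bar>"])
      have f: "f \<in> borel_measurable \<pi>"
        using lim.hyps(4) by (rule borel_measurable_integrable)
      show "L1_approximable \<mu> obs (\<lambda>\<omega>. s i (snd \<omega>))" for i
        by (rule lim.IH)
      show "(\<lambda>\<omega>. f (snd \<omega>)) \<in> borel_measurable \<mu>"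
        by (rule measurable_compose[OF measurable_snd_joint f])
      show "AE \<omega> in \<mu>. (\<lambda>i. s i (snd \<omega>)) \<longlonglongrightarrow> f (snd \<omega>)"
        using lim.hyps(2) by (intro AE_I2) (auto simp: space_pair_measure)
      show "integrable \<mu> (\<lambda>\<omega>. 2 * \<bar>f (snd \<omega>)\<bar>)"
        using lim.hyps(4) f by (subst integral_joint_snd) auto
      show "\<bar>s i (snd \<omega>)\<bar> \<le> 2 * \<bar>f (snd \<omega>)\<bar>" if "\<omega> \<in> space \<mu>" for i \<omega>
        using lim.hyps(3)[of "snd \<omega>" i] that by (auto simp: space_pair_measure)
    qed
  qed
qed

theorem theorem2p2:
  fixes \<X> :: "'a::polish_space set"
    and \<Theta> :: "'b::polish_space set"
    and P :: "'b \<Rightarrow> 'a measure"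
    and \<pi> :: "'b measure"
    and g :: "'b \<Rightarrow> real"
  defines "\<A> \<equiv> restrict_space borel \<X>"
    and "\<B> \<equiv> restrict_space borel \<Theta>"
    and "\<mu> \<equiv> iid_joint (restrict_space borel \<X>) P \<pi>"
  assumes "\<X> \<in> sets borel" and "\<Theta> \<in> sets borel"
    and "\<And>\<theta>. \<theta> \<in> \<Theta> \<Longrightarrow> prob_space (P \<theta>)"
    and "\<And>\<theta>. \<theta> \<in> \<Theta> \<Longrightarrow> sets (P \<theta>) = sets \<A>"
    and "prob_space \<pi>" and "sets \<pi> = sets \<B>"
    and "\<And>A. A \<in> sets \<A> \<Longrightarrow> (\<lambda>\<theta>. measure (P \<theta>) A) \<in> borel_measurable \<B>"
    and "\<And>\<theta> \<theta>'. \<theta> \<in> \<Theta> \<Longrightarrow> \<theta>' \<in> \<Theta> \<Longrightarrow> \<theta> \<noteq> \<theta>' \<Longrightarrow> P \<theta> \<noteq> P \<theta>'"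
    and "g \<in> borel_measurable \<B>"
    and "integrable \<mu> (\<lambda>\<omega>. g (snd \<omega>))"
  shows "AE \<omega> in \<mu>.
    (\<lambda>n. real_cond_exp \<mu> (obs_algebra \<A> \<mu> n) (\<lambda>\<omega>. g (snd \<omega>)) \<omega>) \<longlonglongrightarrow> g (snd \<omega>)"
proof -
  have space_\<pi>: "space \<pi> = \<Theta>"
    using sets_eq_imp_space_eq[OF assms(9)] by (simp add: \<B>_def space_restrict_space)
  have \<mu>: "\<mu> = iid_joint \<A> P \<pi>"
    by (simp add: \<mu>_def \<A>_def)
  interpret iid_model \<A> P \<pi>
    using assms(6-8,10)
    by (intro iid_model.intro) (simp_all add: space_\<pi> measurable_cong_sets[OF assms(9) refl])
  have inj: "inj_on P \<Theta>"
    using assms(11) unfolding inj_on_def by metis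
  have "\<exists>B :: nat \<Rightarrow> 'a set. (\<forall>k. B k \<in> sets \<A>) \<and> inj_on (\<lambda>\<theta> k. measure (P \<theta>) (B k)) \<Theta>"
    unfolding \<A>_def
    by (rule identifiable_imp_countably_identifiable[OF assms(4,6) assms(7)[unfolded \<A>_def] inj])
  then obtain B :: "nat \<Rightarrow> 'a set" where B: "(\<forall>k. B k \<in> sets \<A>) \<and> inj_on (\<lambda>\<theta> k. measure (P \<theta>) (B k)) \<Theta>"
    ..
  have "g \<in> borel_measurable \<pi>"
    using assms(12) by (simp add: measurable_cong_sets[OF assms(9) refl])
  then have "integrable \<pi> g"
    using assms(13) unfolding \<mu> by (simp add: integral_joint_snd)
  then have approx: "L1_approximable (iid_joint \<A> P \<pi>) obs (\<lambda>\<omega>. g (snd \<omega>))"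
    using assms(9) B unfolding \<B>_def
    by (intro L1_approximable_parameter[OF iid_model_axioms _ assms(5), of B]) (simp_all add: space_\<pi>)
  have mono: "sets (obs m) \<subseteq> sets (obs n)" if "m \<le> n" for m n
    using obs_mono[OF that] by (simp add: subalgebra_def)
  show ?thesis
    unfolding \<mu> by (rule joint.levy_upward[OF subalgebra_obs mono approx])
qed

end
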